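(* Let $(M,d)$ be a compact metric space, let $\mu$ be a Borel probability measure on $M$, and let $k:M\times M\to[0,\infty)$ satisfy $k(p,q)=k(q,p)$ for all $p,q\in M$, $k(p,p)=0$ for all $p\in M$, and, for some $L>0$, $|k(p,s)-k(q,s)|\le L\,d(p,q)$ for all $p,q,s\in M$. For $b>0$ and Borel measurable $f\ge 0$ with $\int_M f\,d\mu=1$ define $$U[f](p)=\int_M k(p,q)f(q)\,d\mu(q),\qquad \mathcal{E}_b[f]=\int_M\Big\{\log f+\frac b2 U[f]\Big\}f\,d\mu .$$ Let $A_0,A_1\subseteq M$ be compact sets with $k(p,q)=0$ for all $p,q\in A_j$ ($j=0,1$), and for $\varepsilon>0$ let $B_j(\varepsilon)=\{p\in M: d(p,A_j)<\varepsilon\}$. Assume that for some $\varepsilon_0,\varepsilon_1>0$ there is an injective map $T:B_1(\varepsilon_1)\to B_0(\varepsilon_0)$ (not necessarily onto), with $T$ and $T^{-1}$ measurable, and a constant $c>1$ such that (i) $k(T(p),T(q))\le k(p,q)$ for all $p,q\in B_1(\varepsilon_1)$; (ii) $\mu(T(B))\ge c\,\mu(B)$ for every measurable $B\subseteq B_1(\varepsilon_1)$. Assume also that $k(p,q)>0$ for every $p\in A_1$ and $q\in M\setminus B_1(\varepsilon_1)$. Let $\nu$ be any Borel probability measure on $M$ that is the weak limit of a sequence of measures $g_n\,d\mu$, where $b_n\to\infty$ and each $g_n\ge0$ with $\int_M g_n\,d\mu=1$ satisfies $\mathcal{E}_{b_n}[g_n]=\min_{f\ge0,\ \int_M f\,d\mu=1}\mathcal{E}_{b_n}[f]$.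 Then $\nu(A_1)<1$.
   Context: The convention $0\log 0=0$ is used in the free energy $\mathcal{E}_b$. *)

theory Defs
  imports "HOL-Probability.Probability"
begin

definition admissible :: "'a::metric_space measure \<Rightarrow> ('a \<Rightarrow> real) \<Rightarrow> bool" where
  "admissible \<mu> f \<longleftrightarrow> f \<in> borel_measurable \<mu> \<and> (\<forall>x. 0 \<le> f x)
      \<and> (\<integral>\<^sup>+ x. ennreal (f x) \<partial>\<mu>) = 1"

definition potential :: "'a measure \<Rightarrow> ('a \<Rightarrow> 'a \<Rightarrow> real) \<Rightarrow> ('a \<Rightarrow> real) \<Rightarrow> 'a \<Rightarrow> real" where
  "potential \<mu> k f p = (\<integral> q. k p q * f q \<partial>\<mu>)"

definition energy_density ::
  "'a measure \<Rightarrow> ('a \<Rightarrow> 'a \<Rightarrow> real) \<Rightarrow> real \<Rightarrow> ('a \<Rightarrow> real) \<Rightarrow> 'a \<Rightarrow> real" where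
  "energy_density \<mu> k b f x =
     (if f x = 0 then 0 else f x * ln (f x)) + b / 2 * potential \<mu> k f x * f x"

text \<open>Free energy E_b[f] as an extended real: integral of the positive part minus
  integral of the negative part (the negative part is always finite here, so the
  value lies in (-infinity, +infinity]).\<close>
definition free_energy ::
  "'a measure \<Rightarrow> ('a \<Rightarrow> 'a \<Rightarrow> real) \<Rightarrow> real \<Rightarrow> ('a \<Rightarrow> real) \<Rightarrow> ereal" where
  "free_energy \<mu> k b f =
     enn2ereal (\<integral>\<^sup>+ x. ennreal (energy_density \<mu> k b f x) \<partial>\<mu>)
   - enn2ereal (\<integral>\<^sup>+ x. ennreal (- energy_density \<mu> k b f x) \<partial>\<mu>)"

definition is_minimizer ::
  "'a::metric_space measure \<Rightarrow> ('a \<Rightarrow> 'a \<Rightarrow> real) \<Rightarrow> real \<Rightarrow> ('a \<Rightarrow> real) \<Rightarrow> bool" where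
  "is_minimizer \<mu> k b g \<longleftrightarrow> admissible \<mu> g \<and>
     (\<forall>f. admissible \<mu> f \<longrightarrow> free_energy \<mu> k b g \<le> free_energy \<mu> k b f)"

definition weak_conv :: "(nat \<Rightarrow> 'a::metric_space measure) \<Rightarrow> 'a measure \<Rightarrow> bool" where
  "weak_conv Ms N \<longleftrightarrow> (\<forall>f::'a \<Rightarrow> real. continuous_on UNIV f \<and> bounded (range f) \<longrightarrow>
      (\<lambda>n. \<integral> x. f x \<partial>(Ms n)) \<longlonglongrightarrow> (\<integral> x. f x \<partial>N))"

text \<open>B(A, eps) = {p. d(p,A) < eps}, written as a union of open balls
  (equal to the infdist form for nonempty compact A, and empty for A empty).\<close>
definition nbhd :: "'a::metric_space set \<Rightarrow> real \<Rightarrow> 'a set" where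
  "nbhd A \<epsilon> = {p. \<exists>a\<in>A. dist p a < \<epsilon>}"

end

theory Submission
  imports Defs
begin

text \<open>If \<open>\<nu>(A\<^sub>1) = 1\<close>, the mass \<open>m = \<integral>\<^sub>N g\<^sub>n d\<mu>\<close> of the minimizers in
  \<open>N = B\<^sub>1(\<epsilon>\<^sub>1)\<close> tends to \<open>1\<close>. Transporting the renormalized restriction of \<open>g\<^sub>n\<close> to
  \<open>N\<close> by \<open>T\<close> gives a competitor: it gains \<open>ln c\<close> in entropy and nothing is lost in interaction.
  Discarding the mass \<open>\<delta> = 1 - m\<close> outside \<open>N\<close> saves an interaction energy of order \<open>b \<delta>\<close>, since
  \<open>k\<close> is bounded below between a neighbourhood of \<open>A\<^sub>1\<close> and the complement of \<open>N\<close>; the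
  renormalization by \<open>1/m\<close> costs only \<open>\<delta> (O(1) + \<gamma> b)\<close> with \<open>\<gamma>\<close> as small as desired, because the
  uniform density on a thin neighbourhood of \<open>A\<^sub>1\<close> shows that the minimal energy is at most
  \<open>O(1) + \<gamma> b\<close>. As \<open>\<delta> \<rightarrow> 0\<close> this leaves \<open>ln c \<le> 0\<close>.\<close>

section \<open>Convexity of \<open>x ln x\<close>; measurability of neighbourhoods and Lipschitz
  functions\<close>

text \<open>The left side is the tangent line at \<open>t\<close> of the convex function
  \<open>x ln x\<close>. Keeping \<open>t\<close> free gives, after integration, a tunable lower
  bound on the entropy of a small mass.\<close>

lemma mult_ln_ge:
  fixes x t :: real
  assumes "0 \<le> x" "0 < t"
  shows "x * ln t + x - t \<le> x * ln x"
proof (cases "x = 0")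
  case False
  with assms have x: "0 < x" by simp
  have "ln (t / x) \<le> t / x - 1"
    using x assms by (intro ln_le_minus_one) simp
  then have "x * ln (t / x) \<le> x * (t / x - 1)"
    using x by (intro mult_left_mono) auto
  then show ?thesis
    using x assms by (simp add: ln_div algebra_simps)
qed (use assms in simp)

lemma mult_ln_ge_minus_one:
  fixes x :: real
  assumes "0 \<le> x"
  shows "- 1 \<le> x * ln x"
  using mult_ln_ge[of x 1] assms by simp

lemma open_nbhd: "open (nbhd A e)"
proof -
  have "nbhd A e = (\<Union>a\<in>A. ball a e)" by (auto simp: nbhd_def dist_commute)
  then show ?thesis by auto
qed

lemma nbhd_borel [measurable, simp]: "nbhd A e \<in> sets borel"
  by (intro borel_open open_nbhd)

lemma lipschitz_imp_measurable:
  fixes u :: "'a::metric_space \<Rightarrow> real"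
  assumes "\<And>x y. \<bar>u x - u y\<bar> \<le> C * dist x y"
  shows "u \<in> borel_measurable borel"
proof (rule borel_measurable_continuous_onI)
  \<comment> \<open>\<open>C\<close> carries no sign condition: a negative \<open>C\<close> forces
    all distances to vanish, so the space is a single point and \<open>u\<close> is
    constant.\<close>
  have "0 \<le> C \<or> (\<forall>x y :: 'a. dist x y = 0)"
    by (meson abs_ge_zero assms order_trans zero_le_mult_iff zero_le_dist antisym)
  then show "continuous_on UNIV u"
  proof
    assume "0 \<le> C"
    then have "C-lipschitz_on UNIV u"
      using assms by (intro lipschitz_onI) (auto simp: dist_real_def)
    then show ?thesis by (rule lipschitz_on_continuous_on)
  next
    assume "\<forall>x y :: 'a. dist x y = 0"
    then have "u = (\<lambda>_. u undefined)" by (intro ext) (metis dist_eq_0_iff)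
    then show ?thesis by (metis continuous_on_const)
  qed
qed

section \<open>Lipschitz kernels and their potentials\<close>

locale lipschitz_interaction = prob_space \<mu> for \<mu> :: "'a::metric_space measure" +
  fixes k :: "'a \<Rightarrow> 'a \<Rightarrow> real" and L :: real
  assumes compact_UNIV: "compact (UNIV :: 'a set)"
    and sets_eq_borel [measurable_cong]: "sets \<mu> = sets borel"
    and kernel_nonneg: "0 \<le> k p q"
    and kernel_sym: "k p q = k q p"
    and Lipschitz_pos: "0 < L"
    and kernel_lipschitz: "\<bar>k p s - k q s\<bar> \<le> L * dist p q"
begin

lemma space_eq_UNIV [simp]: "space \<mu> = UNIV"
  using sets_eq_imp_space_eq[OF sets_eq_borel] by simp

lemma prob_UNIV [simp]: "prob UNIV = 1"
  using prob_space by simp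

lemma measurable_eq_borel [simp]: "measurable \<mu> N = measurable borel N"
  by (rule measurable_cong_sets) (simp_all add: sets_eq_borel)

lemma kernel_perturb: "\<bar>k p q - k p' q'\<bar> \<le> L * dist p p' + L * dist q q'"
  using kernel_lipschitz[of p q p'] kernel_lipschitz[of q p' q'] kernel_sym[of p' q]
    kernel_sym[of p' q'] by simp

lemma continuous_on_kernel: "continuous_on S (\<lambda>(p, q). k p q)"
  unfolding continuous_on_iff
proof (intro ballI allI impI)
  fix x :: "'a \<times> 'a" and e :: real assume e: "0 < e"
  \<comment> \<open>Both coordinates move by at most \<open>dist y x\<close>, so the two Lipschitz
    terms add up to less than \<open>2 * e / 3\<close>.\<close>
  have "dist (case y of (p, q) \<Rightarrow> k p q) (case x of (p, q) \<Rightarrow> k p q) < e"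
    if y: "dist y x < e / (3 * L)" for y
  proof -
    have "dist (fst y) (fst x) \<le> dist y x" "dist (snd y) (snd x) \<le> dist y x"
      by (rule dist_fst_le, rule dist_snd_le)
    then have "L * dist (fst y) (fst x) + L * dist (snd y) (snd x) \<le> 2 * (L * dist y x)"
      using Lipschitz_pos by (smt (verit) mult_left_mono)
    moreover have "L * dist y x < e / 3"
      using y Lipschitz_pos by (simp add: field_simps)
    ultimately show ?thesis
      using kernel_perturb[of "fst y" "snd y" "fst x" "snd x"] e
      by (simp add: dist_real_def case_prod_beta)
  qed
  then show "\<exists>d>0. \<forall>x'\<in>S. dist x' x < d \<longrightarrow>
      dist (case x' of (p, q) \<Rightarrow> k p q) (case x of (p, q) \<Rightarrow> k p q) < e"
    using e Lipschitz_pos by (intro exI[of _ "e / (3 * L)"]) simp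
qed

lemma kernel_bounded: obtains K where "0 \<le> K" "\<And>p q. k p q \<le> K"
proof -
  have "bounded ((\<lambda>(p, q). k p q) ` (UNIV \<times> UNIV))"
    by (intro compact_imp_bounded compact_continuous_image continuous_on_kernel compact_Times
        compact_UNIV)
  then obtain K where "\<And>p q. \<bar>k p q\<bar> \<le> K"
    by (force simp: bounded_iff)
  then show ?thesis
    by (meson that abs_ge_self abs_ge_zero order_trans)
qed

lemma kernel_measurable [measurable]: "k p \<in> borel_measurable borel"
proof (rule lipschitz_imp_measurable)
  fix x y show "\<bar>k p x - k p y\<bar> \<le> L * dist x y"
    using kernel_lipschitz[of x p y] by (simp add: kernel_sym[of p])
qed

text \<open>No normalization is imposed on \<open>w\<close>, so that these facts also cover
  restricted densities such as the part of a minimizer inside \<open>N\<close>.\<close>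

context
  fixes w :: "'a \<Rightarrow> real"
  assumes w: "integrable \<mu> w" "\<And>x. 0 \<le> w x"
begin

lemma integrable_kernel_mult: "integrable \<mu> (\<lambda>q. k p q * w q)"
proof -
  obtain K where K: "0 \<le> K" "\<And>p q. k p q \<le> K" by (rule kernel_bounded) auto
  have [measurable]: "w \<in> borel_measurable borel" using borel_measurable_integrable[OF w(1)] by simp
  show ?thesis
  proof (rule Bochner_Integration.integrable_bound[of _ "\<lambda>q. K * w q"])
    show "AE q in \<mu>. norm (k p q * w q) \<le> norm (K * w q)"
      using K w kernel_nonneg by (intro AE_I2) (simp add: mult_right_mono)
  qed (use w in auto)
qed

lemma potential_nonneg: "0 \<le> potential \<mu> k w p"
  unfolding potential_def using w kernel_nonneg by (intro integral_nonneg_AE AE_I2) simp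

lemma potential_bounded:
  assumes "\<And>p q. k p q \<le> K"
  shows "potential \<mu> k w p \<le> K * (\<integral>x. w x \<partial>\<mu>)"
proof -
  have "potential \<mu> k w p \<le> (\<integral>x. K * w x \<partial>\<mu>)"
    unfolding potential_def using w assms
    by (intro integral_mono integrable_kernel_mult) (auto simp: mult_right_mono)
  then show ?thesis by simp
qed

text \<open>Integration preserves the Lipschitz bound of \<open>k\<close>, scaled by the mass of
  \<open>w\<close>. This makes the potential continuous, hence measurable, without a joint
  measurability argument for \<open>k\<close>.\<close>

lemma potential_lipschitz:
  "\<bar>potential \<mu> k w p - potential \<mu> k w q\<bar> \<le> (L * (\<integral>x. w x \<partial>\<mu>)) * dist p q"
proof -
  have "potential \<mu> k w p - potential \<mu> k w q = (\<integral>x. k p x * w x - k q x * w x \<partial>\<mu>)"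
    unfolding potential_def by (simp add: integrable_kernel_mult)
  also have "\<bar>\<dots>\<bar> \<le> (\<integral>x. \<bar>k p x * w x - k q x * w x\<bar> \<partial>\<mu>)"
    by (rule integral_abs_bound)
  also have "\<dots> \<le> (\<integral>x. L * dist p q * w x \<partial>\<mu>)"
    using w kernel_lipschitz[of p _ q]
    by (intro integral_mono integrable_abs Bochner_Integration.integrable_diff integrable_kernel_mult)
      (auto simp flip: left_diff_distrib simp: abs_mult intro!: mult_right_mono)
  finally show ?thesis by (simp add: mult_ac)
qed

lemma potential_measurable [measurable]: "potential \<mu> k w \<in> borel_measurable borel"
  by (rule lipschitz_imp_measurable) (rule potential_lipschitz)

lemma integrable_potential_mult:
  assumes v: "integrable \<mu> v"
  shows "integrable \<mu> (\<lambda>p. potential \<mu> k w p * v p)"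
proof -
  obtain K where K: "0 \<le> K" "\<And>p q. k p q \<le> K" by (rule kernel_bounded) auto
  have [measurable]: "v \<in> borel_measurable borel" using borel_measurable_integrable[OF v] by simp
  show ?thesis
  proof (rule Bochner_Integration.integrable_bound[of _ "\<lambda>q. (K * (\<integral>x. w x \<partial>\<mu>)) * v q"])
    have "\<bar>potential \<mu> k w p\<bar> \<le> \<bar>K * (\<integral>x. w x \<partial>\<mu>)\<bar>" for p
      using potential_nonneg potential_bounded[OF K(2)] by (smt (verit))
    then show "AE q in \<mu>. norm (potential \<mu> k w q * v q) \<le> norm ((K * (\<integral>x. w x \<partial>\<mu>)) * v q)"
      by (intro AE_I2) (simp only: real_norm_def abs_mult[of _ "v _"], rule mult_right_mono, auto)
  qed (use v in auto)
qed

end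

lemma potential_mono:
  assumes "integrable \<mu> v" "integrable \<mu> w" "\<And>x. 0 \<le> v x" "\<And>x. v x \<le> w x"
  shows "potential \<mu> k v p \<le> potential \<mu> k w p"
proof -
  have "0 \<le> w x" for x using assms(3,4) by (meson order_trans)
  then show ?thesis
    unfolding potential_def using assms kernel_nonneg
    by (intro integral_mono integrable_kernel_mult) (auto simp: mult_left_mono)
qed

section \<open>Admissible densities and the free energy as a real number\<close>

lemma admissible_iff:
  "admissible \<mu> f \<longleftrightarrow> integrable \<mu> f \<and> (\<forall>x. 0 \<le> f x) \<and> (\<integral>x. f x \<partial>\<mu>) = 1"
proof
  assume f: "admissible \<mu> f"
  then have nn: "(\<integral>\<^sup>+ x. ennreal (f x) \<partial>\<mu>) = ennreal 1"
    by (simp add: admissible_def)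
  then have "integrable \<mu> f" "(\<integral>x. f x \<partial>\<mu>) = 1"
    using f nn_integral_eq_integrable[of f \<mu> 1] by (auto simp: admissible_def)
  then show "integrable \<mu> f \<and> (\<forall>x. 0 \<le> f x) \<and> (\<integral>x. f x \<partial>\<mu>) = 1"
    using f by (simp add: admissible_def)
next
  assume f: "integrable \<mu> f \<and> (\<forall>x. 0 \<le> f x) \<and> (\<integral>x. f x \<partial>\<mu>) = 1"
  then have "(\<integral>\<^sup>+ x. ennreal (f x) \<partial>\<mu>) = ennreal 1"
    by (subst nn_integral_eq_integral) auto
  then show "admissible \<mu> f"
    using f borel_measurable_integrable[of \<mu> f] by (simp add: admissible_def)
qed

abbreviation neg_entropy :: "('a \<Rightarrow> real) \<Rightarrow> real" where
  "neg_entropy f \<equiv> (\<integral>x. f x * ln (f x) \<partial>\<mu>)"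

abbreviation interaction :: "('a \<Rightarrow> real) \<Rightarrow> real" where
  "interaction f \<equiv> (\<integral>x. potential \<mu> k f x * f x \<partial>\<mu>)"

text \<open>Where \<open>f x = 0\<close> the product with the logarithm is 0 whatever
  \<open>ln 0\<close> is, so the convention 0 log 0 = 0 holds without a case distinction.\<close>

lemma energy_density_eq:
  "energy_density \<mu> k b f x = f x * ln (f x) + b / 2 * (potential \<mu> k f x * f x)"
  by (simp add: energy_density_def)

text \<open>The potential of \<open>f\<close> is bounded, so the interaction is integrable; with
  integrable entropy both integrals in the extended difference are finite.\<close>

lemma free_energy_eq:
  assumes f: "admissible \<mu> f" and ent: "integrable \<mu> (\<lambda>x. f x * ln (f x))"
  shows "free_energy \<mu> k b f = ereal (neg_entropy f + b / 2 * interaction f)"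
proof -
  have int: "integrable \<mu> (\<lambda>x. potential \<mu> k f x * f x)"
    using f by (intro integrable_potential_mult) (auto simp: admissible_iff)
  let ?e = "energy_density \<mu> k b f"
  have e: "integrable \<mu> ?e"
    unfolding energy_density_eq[abs_def] using ent int by auto
  have fin: "(\<integral>\<^sup>+ x. ennreal (?e x) \<partial>\<mu>) \<noteq> \<infinity>" "(\<integral>\<^sup>+ x. ennreal (- ?e x) \<partial>\<mu>) \<noteq> \<infinity>"
    using e by (auto simp: real_integrable_def)
  have "ereal (\<integral>x. ?e x \<partial>\<mu>) = free_energy \<mu> k b f"
    unfolding free_energy_def real_lebesgue_integral_def[OF e]
    using fin by (metis enn2ereal_ennreal enn2real_nonneg ennreal_enn2real ereal_minus(1)
        infinity_ennreal_def less_top)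
  moreover have "(\<integral>x. ?e x \<partial>\<mu>) = neg_entropy f + b / 2 * interaction f"
    unfolding energy_density_eq[abs_def] using ent int by simp
  ultimately show ?thesis by simp
qed

text \<open>Since \<open>x ln x\<close> is at least -1 and the potential is nonnegative, the
  negative part of the energy density has integral at most 1. Finite energy then bounds the positive
  part too, and subtracting the integrable interaction leaves the entropy.\<close>

lemma integrable_entropy_if_finite_free_energy:
  assumes f: "admissible \<mu> f" and b: "0 \<le> b" and fin: "free_energy \<mu> k b f < \<infinity>"
  shows "integrable \<mu> (\<lambda>x. f x * ln (f x))"
proof -
  have f': "integrable \<mu> f" "\<And>x. 0 \<le> f x" using f by (auto simp: admissible_iff)
  have [measurable]: "f \<in> borel_measurable borel" using borel_measurable_integrable[OF f'(1)] by simp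
  have [measurable]: "potential \<mu> k f \<in> borel_measurable borel"
    using f' by (rule potential_measurable)
  have int: "integrable \<mu> (\<lambda>x. potential \<mu> k f x * f x)"
    using f' by (intro integrable_potential_mult)
  let ?e = "energy_density \<mu> k b f"
  have [measurable]: "?e \<in> borel_measurable borel"
    unfolding energy_density_eq[abs_def] by measurable
  have "- ?e x \<le> 1" for x
    using mult_ln_ge_minus_one[OF f'(2)[of x]] f'(2)[of x] potential_nonneg[OF f', of x] b
    unfolding energy_density_eq by (smt (verit) divide_nonneg_nonneg mult_nonneg_nonneg)
  then have "(\<integral>\<^sup>+ x. ennreal (- ?e x) \<partial>\<mu>) \<le> (\<integral>\<^sup>+ x. 1 \<partial>\<mu>)"
    by (intro nn_integral_mono) simp
  also have "\<dots> = 1" using emeasure_space_1 by simp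
  finally have neg: "(\<integral>\<^sup>+ x. ennreal (- ?e x) \<partial>\<mu>) \<noteq> \<infinity>"
    by (auto simp: top_unique)
  moreover have "(\<integral>\<^sup>+ x. ennreal (?e x) \<partial>\<mu>) \<noteq> \<infinity>"
  proof
    assume "(\<integral>\<^sup>+ x. ennreal (?e x) \<partial>\<mu>) = \<infinity>"
    with neg fin show False
      by (cases "\<integral>\<^sup>+ x. ennreal (- ?e x) \<partial>\<mu>") (auto simp: free_energy_def enn2ereal_ennreal)
  qed
  ultimately have "integrable \<mu> ?e"
    by (auto simp: real_integrable_def)
  then have "integrable \<mu> (\<lambda>x. ?e x - b / 2 * (potential \<mu> k f x * f x))"
    using int by auto
  then show ?thesis
    by (simp add: energy_density_eq)
qed

text \<open>The normalized indicator of \<open>B\<close> has entropy \<open>- ln (prob B)\<close>,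
  and its interaction averages \<open>k\<close> over pairs in \<open>B\<close>. It is the trial
  density that bounds the minimal energy from above.\<close>

lemma free_energy_uniform_density:
  assumes B: "B \<in> sets borel" "0 < prob B" and b: "0 \<le> b"
    and K: "\<And>p q. p \<in> B \<Longrightarrow> q \<in> B \<Longrightarrow> k p q \<le> K"
  obtains w where "admissible \<mu> w" "free_energy \<mu> k b w \<le> ereal (b / 2 * K - ln (prob B))"
proof -
  define w where "w x = indicator B x / prob B" for x :: 'a
  have int_B: "integrable \<mu> (indicator B :: 'a \<Rightarrow> real)"
    using B by (simp add: sets_eq_borel less_top[symmetric])
  have w: "integrable \<mu> w" "\<And>x. 0 \<le> w x" "(\<integral>x. w x \<partial>\<mu>) = 1"
    using B int_B by (auto simp: w_def[abs_def])
  then have adm: "admissible \<mu> w" by (simp add: admissible_iff)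
  have w_ln: "(\<lambda>x. w x * ln (w x)) = (\<lambda>x. - ln (prob B) * w x)"
    using B by (auto simp: w_def ln_div split: split_indicator)
  have ent: "integrable \<mu> (\<lambda>x. w x * ln (w x))" "neg_entropy w = - ln (prob B)"
    unfolding w_ln using w by auto
  have "potential \<mu> k w p \<le> K" if p: "p \<in> B" for p
  proof -
    have "k p q * w q \<le> K * w q" for q
      using K[OF p, of q] w(2)[of q] B by (cases "q \<in> B") (auto simp: w_def intro: divide_right_mono)
    then have "potential \<mu> k w p \<le> (\<integral>q. K * w q \<partial>\<mu>)"
      unfolding potential_def using w by (intro integral_mono integrable_kernel_mult) auto
    then show ?thesis using w by simp
  qed
  then have "potential \<mu> k w p * w p \<le> K * w p" for p
    using B w(2)[of p] by (cases "p \<in> B") (auto simp: w_def intro: divide_right_mono)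
  then have "interaction w \<le> (\<integral>p. K * w p \<partial>\<mu>)"
    using w by (intro integral_mono integrable_potential_mult) auto
  then have "interaction w \<le> K" using w by simp
  then have "b / 2 * interaction w \<le> b / 2 * K" using b by (intro mult_left_mono) auto
  then have "free_energy \<mu> k b w \<le> ereal (b / 2 * K - ln (prob B))"
    using free_energy_eq[OF adm ent(1), of b] ent(2) by simp
  with adm show ?thesis by (rule that)
qed

section \<open>Transport of densities by the expanding map \<open>T\<close>\<close>

context
  fixes N :: "'a set" and T :: "'a \<Rightarrow> 'a" and c :: real
  assumes N [measurable]: "N \<in> sets borel"
    and T_vimage: "\<And>C. C \<in> sets borel \<Longrightarrow> T -` C \<inter> N \<in> sets borel"
    and T_image: "\<And>B. B \<in> sets borel \<Longrightarrow> B \<subseteq> N \<Longrightarrow> T ` B \<in> sets borel"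
    and T_expands: "\<And>B. B \<in> sets borel \<Longrightarrow> B \<subseteq> N \<Longrightarrow> c * prob B \<le> prob (T ` B)"
    and c_gt_1: "1 < c"
begin

text \<open>\<open>r\<close> is the density of the image under \<open>T\<close> of
  \<open>\<mu>\<close> restricted to \<open>N\<close>, a reciprocal Jacobian: expansion by at least
  \<open>c\<close> makes this image measure at most \<open>\<mu> / c\<close>. Positivity is stated
  only along \<open>T\<close>, because \<open>r\<close> may vanish off its image. The last two
  clauses are the change of variables.\<close>

lemma transport_density:
  obtains r :: "'a \<Rightarrow> real" where "r \<in> borel_measurable borel" "\<And>y. 0 \<le> r y"
    "AE x in \<mu>. x \<in> N \<longrightarrow> 0 < r (T x) \<and> r (T x) \<le> 1 / c"
    "\<And>F :: 'a \<Rightarrow> real. F \<in> borel_measurable borel \<Longrightarrow>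
      integrable \<mu> (\<lambda>y. r y * F y) \<longleftrightarrow> integrable \<mu> (\<lambda>x. indicator N x * F (T x))"
    "\<And>F :: 'a \<Rightarrow> real. F \<in> borel_measurable borel \<Longrightarrow>
      (\<integral>y. r y * F y \<partial>\<mu>) = (\<integral>x. indicator N x * F (T x) \<partial>\<mu>)"
proof -
  define \<rho> where "\<rho> = restrict_space \<mu> N"
  define \<sigma> where "\<sigma> = distr \<rho> borel T"
  have N_space: "N \<inter> space \<mu> \<in> sets \<mu>" using N sets_eq_borel by simp
  have T [measurable]: "T \<in> measurable \<rho> borel"
  proof (rule measurableI)
    fix C :: "'a set" assume "C \<in> sets borel"
    then show "T -` C \<inter> space \<rho> \<in> sets \<rho>"
      using T_vimage N_space by (simp add: \<rho>_def space_restrict_space sets_restrict_space_iff sets_eq_borel)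
  qed simp
  have sets_sigma: "sets \<sigma> = sets \<mu>" by (simp add: \<sigma>_def sets_eq_borel)
  have \<sigma>: "emeasure \<sigma> C = ennreal (prob (T -` C \<inter> N))" if C: "C \<in> sets borel" for C
  proof -
    have "emeasure \<sigma> C = emeasure \<rho> (T -` C \<inter> space \<rho>)"
      using C by (simp add: \<sigma>_def emeasure_distr)
    also have "\<dots> = emeasure \<mu> (T -` C \<inter> N)"
      using N_space by (simp add: \<rho>_def space_restrict_space emeasure_restrict_space)
    finally show ?thesis by (simp add: emeasure_eq_measure)
  qed
  \<comment> \<open>This is the domination \<open>\<sigma> \<le> \<mu> / c\<close>, from expansion
    applied to the part of \<open>N\<close> that \<open>T\<close> sends into
    \<open>C\<close>.\<close>
  have contract: "c * prob (T -` C \<inter> N) \<le> prob C" if C: "C \<in> sets borel" for C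
  proof -
    have "c * prob (T -` C \<inter> N) \<le> prob (T ` (T -` C \<inter> N))"
      using C by (intro T_expands T_vimage) auto
    also have "\<dots> \<le> prob C"
      using C by (intro finite_measure_mono) (auto simp: sets_eq_borel)
    finally show ?thesis .
  qed
  have "absolutely_continuous \<mu> \<sigma>"
    unfolding absolutely_continuous_def
  proof
    fix C assume C: "C \<in> null_sets \<mu>"
    then have C': "C \<in> sets borel" "prob C = 0"
      by (auto simp: sets_eq_borel measure_eq_0_null_sets)
    then have "prob (T -` C \<inter> N) = 0"
      using contract[of C] c_gt_1 measure_nonneg[of \<mu> "T -` C \<inter> N"]
      by (simp add: mult_le_0_iff)
    then show "C \<in> null_sets \<sigma>"
      using C' \<sigma>[of C] sets_sigma by (intro null_setsI) (auto simp: sets_eq_borel)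
  qed
  from Radon_Nikodym[OF this sets_sigma] obtain R where
    R [measurable]: "R \<in> borel_measurable borel" and R_dens: "density \<mu> R = \<sigma>" by auto
  \<comment> \<open>\<open>R\<close> takes extended values; the image measure is finite, so
    \<open>R\<close> is finite almost everywhere and sending infinity to 0 changes only a null
    set.\<close>
  define r where "r y = enn2real (R y)" for y
  have r [measurable]: "r \<in> borel_measurable borel" unfolding r_def by measurable
  have r_nonneg: "0 \<le> r y" for y by (simp add: r_def)
  have "(\<integral>\<^sup>+y. R y \<partial>\<mu>) = emeasure \<sigma> UNIV"
    by (simp add: R_dens[symmetric] emeasure_density)
  also have "\<dots> \<noteq> \<infinity>" by (simp add: \<sigma>)
  finally have "AE y in \<mu>. R y \<noteq> \<infinity>"
    by (intro nn_integral_PInf_AE) auto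
  then have "AE y in \<mu>. R y = ennreal (r y)"
    by eventually_elim (simp add: r_def less_top)
  then have dens: "density \<mu> (\<lambda>y. ennreal (r y)) = \<sigma>"
    unfolding R_dens[symmetric] by (intro density_cong) auto
  have integrable_iff: "integrable \<mu> (\<lambda>y. r y * F y) \<longleftrightarrow> integrable \<mu> (\<lambda>x. indicator N x * F (T x))"
    if [measurable]: "F \<in> borel_measurable borel" for F :: "'a \<Rightarrow> real"
  proof -
    have "integrable \<mu> (\<lambda>y. r y * F y) \<longleftrightarrow> integrable \<sigma> F"
      unfolding dens[symmetric] by (subst integrable_density) (auto simp: r_nonneg)
    also have "\<dots> \<longleftrightarrow> integrable \<rho> (\<lambda>x. F (T x))"
      unfolding \<sigma>_def by (rule integrable_distr_eq) auto
    also have "\<dots> \<longleftrightarrow> integrable \<mu> (\<lambda>x. indicator N x * F (T x))"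
      unfolding \<rho>_def using N_space by (simp add: integrable_restrict_space)
    finally show ?thesis .
  qed
  have integral_eq: "(\<integral>y. r y * F y \<partial>\<mu>) = (\<integral>x. indicator N x * F (T x) \<partial>\<mu>)"
    if [measurable]: "F \<in> borel_measurable borel" for F :: "'a \<Rightarrow> real"
  proof -
    have "(\<integral>y. r y * F y \<partial>\<mu>) = (\<integral>y. F y \<partial>\<sigma>)"
      unfolding dens[symmetric] by (subst integral_density) (auto simp: r_nonneg)
    also have "\<dots> = (\<integral>x. F (T x) \<partial>\<rho>)"
      unfolding \<sigma>_def by (rule integral_distr) auto
    also have "\<dots> = (\<integral>x. indicator N x * F (T x) \<partial>\<mu>)"
      unfolding \<rho>_def using N_space by (simp add: integral_restrict_space)
    finally show ?thesis .
  qed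
  have r_le: "AE y in \<mu>. r y \<le> 1 / c"
  proof -
    \<comment> \<open>On \<open>B\<close> the function \<open>r - 1 / c\<close> is strictly
      positive, yet its integral over \<open>B\<close> is at most 0 by \<open>contract\<close>;
      hence \<open>B\<close> is null.\<close>
    define B where "B = {y. 1 / c < r y}"
    have B [measurable]: "B \<in> sets borel" unfolding B_def by measurable
    have int_B: "integrable \<mu> (indicator B :: 'a \<Rightarrow> real)"
      using B by (simp add: sets_eq_borel less_top[symmetric])
    have TB: "(\<lambda>x. indicator N x * indicator B (T x)) = (indicator (T -` B \<inter> N) :: 'a \<Rightarrow> real)"
      by (auto simp: fun_eq_iff split: split_indicator)
    have "integrable \<mu> (indicator (T -` B \<inter> N) :: 'a \<Rightarrow> real)"
      using T_vimage[OF B] by (simp add: sets_eq_borel less_top[symmetric])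
    then have int_rB: "integrable \<mu> (\<lambda>y. r y * indicator B y)"
      by (subst integrable_iff) (simp_all add: TB)
    have "(\<integral>y. r y * indicator B y - 1 / c * indicator B y \<partial>\<mu>)
        = (\<integral>y. r y * indicator B y \<partial>\<mu>) - 1 / c * prob B"
      using int_B int_rB by (subst Bochner_Integration.integral_diff) auto
    also have "\<dots> = prob (T -` B \<inter> N) - 1 / c * prob B"
      by (subst integral_eq) (simp_all add: TB)
    also have "\<dots> \<le> 0"
      using contract[OF B] c_gt_1 by (simp add: field_simps)
    finally have le: "(\<integral>y. r y * indicator B y - 1 / c * indicator B y \<partial>\<mu>) \<le> 0" .
    have nonneg: "0 \<le> r y * indicator B y - 1 / c * indicator B y" for y
      by (auto simp: B_def split: split_indicator)
    then have "(\<integral>y. r y * indicator B y - 1 / c * indicator B y \<partial>\<mu>) = 0"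
      using le by (intro antisym integral_nonneg_AE AE_I2) auto
    then have "AE y in \<mu>. r y * indicator B y - 1 / c * indicator B y = 0"
      using int_B int_rB nonneg by (subst (asm) integral_nonneg_eq_0_iff_AE) auto
    then show ?thesis
      by eventually_elim (auto simp: B_def split: split_indicator_asm)
  qed
  \<comment> \<open>A measure with density \<open>r\<close> gives no mass to the zeros of
    \<open>r\<close>; pulling back along \<open>T\<close> yields positivity almost everywhere on
    \<open>N\<close>.\<close>
  have "AE y in \<sigma>. 0 < r y \<and> r y \<le> 1 / c"
    unfolding dens[symmetric] using r_le by (subst AE_density) auto
  then have "AE x in \<rho>. 0 < r (T x) \<and> r (T x) \<le> 1 / c"
    unfolding \<sigma>_def by (subst (asm) AE_distr_iff) auto
  then have "AE x in \<mu>. x \<in> N \<longrightarrow> 0 < r (T x) \<and> r (T x) \<le> 1 / c"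
    unfolding \<rho>_def using N_space by (subst (asm) AE_restrict_space_iff) auto
  with r r_nonneg show ?thesis
    using integrable_iff integral_eq by (rule that)
qed

text \<open>\<open>f\<close> is the density of the image under \<open>T\<close> of
  \<open>h d\<mu>\<close>. Along \<open>T\<close> it equals \<open>h\<close> times a factor at most
  \<open>1 / c\<close> almost everywhere, so \<open>neg_entropy\<close> drops by at least
  \<open>ln c\<close>; the interaction cannot grow since \<open>T\<close> does not increase
  \<open>k\<close>.\<close>

lemma transport_decreases_energy:
  assumes T_inj: "inj_on T N"
    and T_kernel: "\<And>p q. p \<in> N \<Longrightarrow> q \<in> N \<Longrightarrow> k (T p) (T q) \<le> k p q"
    and h: "admissible \<mu> h" and h_supp: "\<And>x. x \<notin> N \<Longrightarrow> h x = 0"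
    and h_ent: "integrable \<mu> (\<lambda>x. h x * ln (h x))"
  obtains f where "admissible \<mu> f" "integrable \<mu> (\<lambda>x. f x * ln (f x))"
    "neg_entropy f \<le> neg_entropy h - ln c" "interaction f \<le> interaction h"
proof -
  obtain r where r [measurable]: "r \<in> borel_measurable borel" and r_nonneg: "\<And>y. 0 \<le> r y"
    and r_AE: "AE x in \<mu>. x \<in> N \<longrightarrow> 0 < r (T x) \<and> r (T x) \<le> 1 / c"
    and r_integrable: "\<And>F :: 'a \<Rightarrow> real. F \<in> borel_measurable borel \<Longrightarrow>
      integrable \<mu> (\<lambda>y. r y * F y) \<longleftrightarrow> integrable \<mu> (\<lambda>x. indicator N x * F (T x))"
    and r_integral: "\<And>F :: 'a \<Rightarrow> real. F \<in> borel_measurable borel \<Longrightarrow>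
      (\<integral>y. r y * F y \<partial>\<mu>) = (\<integral>x. indicator N x * F (T x) \<partial>\<mu>)"
    by (rule transport_density) (rule that, assumption+)
  have h': "integrable \<mu> h" "\<And>x. 0 \<le> h x" "(\<integral>x. h x \<partial>\<mu>) = 1"
    using h by (auto simp: admissible_iff)
  have h_meas [measurable]: "h \<in> borel_measurable borel"
    using borel_measurable_integrable[OF h'(1)] by simp
  \<comment> \<open>\<open>S\<close> inverts \<open>T\<close> on its image. The constant value
    elsewhere keeps \<open>S\<close> measurable on the whole space and never enters, since integrals
    against \<open>r\<close> see only points \<open>T x\<close> with \<open>x\<close> in
    \<open>N\<close>.\<close>
  define S where "S y = (if y \<in> T ` N then inv_into N T y else undefined)" for y
  have S: "S (T x) = x" if "x \<in> N" for x
    using that T_inj by (simp add: S_def)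
  have S_meas [measurable]: "S \<in> measurable borel borel"
  proof (rule measurableI)
    fix C :: "'a set" assume C: "C \<in> sets borel"
    have "S -` C = T ` (C \<inter> N) \<union> (if undefined \<in> C then - (T ` N) else {})"
    proof -
      have 1: "y \<in> S -` C \<longleftrightarrow> y \<in> T ` (C \<inter> N)" if "y \<in> T ` N" for y
        using that T_inj by (auto simp: S inj_on_def)
      have 2: "y \<in> S -` C \<longleftrightarrow> undefined \<in> C" if "y \<notin> T ` N" for y
        using that by (simp add: S_def)
      show ?thesis
      proof (rule set_eqI)
        fix y
        show "y \<in> S -` C \<longleftrightarrow> y \<in> T ` (C \<inter> N) \<union> (if undefined \<in> C then - (T ` N) else {})"
        proof (cases "y \<in> T ` N")
          case True then show ?thesis using 1[OF True] by auto
        next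
          case False then show ?thesis using 2[OF False] by auto
        qed
      qed
    qed
    moreover have "T ` (C \<inter> N) \<in> sets borel" "T ` N \<in> sets borel"
      using C by (auto intro!: T_image)
    ultimately show "S -` C \<inter> space borel \<in> sets borel" by auto
  qed simp
  define f where "f y = r y * h (S y)" for y
  have f_meas [measurable]: "f \<in> borel_measurable borel" unfolding f_def by measurable
  have f_nonneg: "0 \<le> f y" for y using r_nonneg h' by (simp add: f_def)
  \<comment> \<open>Integrability is an equivalence because it is used in both directions
    below.\<close>
  have change: "(\<integral>y. G y * f y \<partial>\<mu>) = (\<integral>x. G (T x) * h x \<partial>\<mu>)"
    "integrable \<mu> (\<lambda>y. G y * f y) \<longleftrightarrow> integrable \<mu> (\<lambda>x. G (T x) * h x)"
    if [measurable]: "G \<in> borel_measurable borel" for G :: "'a \<Rightarrow> real"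
  proof -
    have *: "(\<lambda>x. indicator N x * (G (T x) * h (S (T x)))) = (\<lambda>x. G (T x) * h x)"
      using S h_supp by (auto simp: fun_eq_iff split: split_indicator)
    have **: "(\<lambda>y. G y * f y) = (\<lambda>y. r y * (G y * h (S y)))"
      by (simp add: f_def mult_ac)
    show "(\<integral>y. G y * f y \<partial>\<mu>) = (\<integral>x. G (T x) * h x \<partial>\<mu>)"
      unfolding ** by (subst r_integral) (simp_all add: *)
    show "integrable \<mu> (\<lambda>y. G y * f y) \<longleftrightarrow> integrable \<mu> (\<lambda>x. G (T x) * h x)"
      unfolding ** by (subst r_integrable) (simp_all add: *)
  qed
  have f: "integrable \<mu> f" "(\<integral>y. f y \<partial>\<mu>) = 1"
    using change[of "\<lambda>_. 1"] h' by simp_all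
  have f_adm: "admissible \<mu> f"
    using f f_nonneg by (simp add: admissible_iff)

  \<comment> \<open>Where \<open>h\<close> vanishes both sides are 0; elsewhere
    \<open>ln (f (T x))\<close> splits into \<open>ln (r (T x)) + ln (h x)\<close>, and the bound on
    \<open>r\<close> gives \<open>- ln c\<close>.\<close>
  have le_AE: "AE x in \<mu>. ln (f (T x)) * h x \<le> h x * ln (h x) - ln c * h x"
    using r_AE
  proof eventually_elim
    case (elim x)
    show ?case
    proof (cases "x \<in> N \<and> h x \<noteq> 0")
      case True
      then have *: "0 < r (T x)" "r (T x) \<le> 1 / c" "0 < h x" "f (T x) = r (T x) * h x"
        using elim h'(2)[of x] S by (auto simp: f_def)
      then have "ln (r (T x)) \<le> ln (1 / c)" using c_gt_1 by (subst ln_le_cancel_iff) auto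
      then have "ln (f (T x)) \<le> ln (h x) - ln c"
        using * c_gt_1 by (simp add: ln_mult ln_div)
      then have "ln (f (T x)) * h x \<le> (ln (h x) - ln c) * h x"
        using h' by (intro mult_right_mono) auto
      then show ?thesis by (simp add: algebra_simps)
    qed (use h_supp in auto)
  qed

  \<comment> \<open>The density \<open>r\<close> may be arbitrarily small, so \<open>le_AE\<close> controls only the positive part of
    \<open>f ln f\<close>; the negative part is bounded by \<open>1\<close> pointwise.\<close>
  have neg: "integrable \<mu> (\<lambda>y. max 0 (- ln (f y)) * f y)"
  proof (rule Bochner_Integration.integrable_bound[of _ "\<lambda>_. 1 :: real"])
    show "AE y in \<mu>. norm (max 0 (- ln (f y)) * f y) \<le> norm (1 :: real)"
    proof (rule AE_I2)
      fix y
      show "norm (max 0 (- ln (f y)) * f y) \<le> norm (1 :: real)"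
        using f_nonneg[of y] mult_ln_ge_minus_one[OF f_nonneg[of y]]
        by (auto simp: max_def mult_nonpos_nonneg abs_mult mult.commute)
    qed
  qed auto
  have "integrable \<mu> (\<lambda>x. max 0 (ln (f (T x))) * h x)"
  proof (rule Bochner_Integration.integrable_bound[OF h_ent])
    show "(\<lambda>x. max 0 (ln (f (T x))) * h x) \<in> borel_measurable \<mu>"
    proof -
      \<comment> \<open>\<open>T\<close> is measurable only on \<open>N\<close>, so it is replaced
        by a constant outside; \<open>h\<close> vanishes there and the product does not
        change.\<close>
      have T_meas: "(\<lambda>x. if x \<in> N then T x else undefined) \<in> measurable borel borel"
      proof (rule measurableI)
        fix C :: "'a set" assume C: "C \<in> sets borel"
        have "(\<lambda>x. if x \<in> N then T x else undefined) -` C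
            = (T -` C \<inter> N) \<union> (if undefined \<in> C then - N else {})"
          by (auto split: if_splits)
        then show "(\<lambda>x. if x \<in> N then T x else undefined) -` C \<inter> space borel \<in> sets borel"
          using T_vimage[OF C] N by simp
      qed simp
      have "(\<lambda>x. max 0 (ln (f (if x \<in> N then T x else undefined))) * h x) \<in> borel_measurable borel"
        using measurable_compose[OF T_meas f_meas] by measurable
      moreover have "(\<lambda>x. max 0 (ln (f (if x \<in> N then T x else undefined))) * h x)
          = (\<lambda>x. max 0 (ln (f (T x))) * h x)"
        using h_supp by auto
      ultimately show ?thesis by simp
    qed
    show "AE x in \<mu>. norm (max 0 (ln (f (T x))) * h x) \<le> norm (h x * ln (h x))"
      using le_AE
    proof eventually_elim
      case (elim x)
      have "0 \<le> ln c * h x" using c_gt_1 h'(2)[of x] by simp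
      with elim have "ln (f (T x)) * h x \<le> \<bar>h x * ln (h x)\<bar>" by linarith
      then show ?case
        using h'(2)[of x] by (auto simp: max_def)
    qed
  qed
  then have pos: "integrable \<mu> (\<lambda>y. max 0 (ln (f y)) * f y)"
    by (subst change) auto
  have "integrable \<mu> (\<lambda>y. max 0 (ln (f y)) * f y - max 0 (- ln (f y)) * f y)"
    using pos neg by (rule Bochner_Integration.integrable_diff)
  also have "(\<lambda>y. max 0 (ln (f y)) * f y - max 0 (- ln (f y)) * f y) = (\<lambda>y. ln (f y) * f y)"
    by (auto simp: max_def fun_eq_iff)
  finally have ent: "integrable \<mu> (\<lambda>y. ln (f y) * f y)" .
  have "(\<integral>y. ln (f y) * f y \<partial>\<mu>) = (\<integral>x. ln (f (T x)) * h x \<partial>\<mu>)"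
    by (rule change) auto
  also have "\<dots> \<le> (\<integral>x. h x * ln (h x) - ln c * h x \<partial>\<mu>)"
  proof (rule integral_mono_AE[OF _ _ le_AE])
    show "integrable \<mu> (\<lambda>x. ln (f (T x)) * h x)"
      using ent by (subst (asm) change) auto
  qed (use h_ent h' in auto)
  also have "\<dots> = neg_entropy h - ln c" using h_ent h' by simp
  finally have "neg_entropy f \<le> neg_entropy h - ln c" by (simp add: mult.commute)

  moreover have "interaction f \<le> interaction h"
  proof -
    have [measurable]: "potential \<mu> k f \<in> borel_measurable borel"
      using f f_nonneg by (intro potential_measurable) auto
    \<comment> \<open>With \<open>G = k (T x)\<close> the change of variables leaves an integral
      against \<open>h\<close>, which lives on \<open>N\<close>, where \<open>T\<close> does not
      increase \<open>k\<close>. A second change of variables then compares the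
      interactions.\<close>
    have "potential \<mu> k f (T x) \<le> potential \<mu> k h x" if x: "x \<in> N" for x
    proof -
      have "potential \<mu> k f (T x) = (\<integral>q. k (T x) (T q) * h q \<partial>\<mu>)"
        unfolding potential_def by (rule change) auto
      also have "\<dots> \<le> (\<integral>q. k x q * h q \<partial>\<mu>)"
      proof (rule integral_mono)
        show "integrable \<mu> (\<lambda>q. k (T x) (T q) * h q)"
          using integrable_kernel_mult[OF f(1) f_nonneg, of "T x"] by (subst (asm) change) auto
        show "k (T x) (T q) * h q \<le> k x q * h q" for q
          using T_kernel[OF x, of q] h_supp[of q] h'(2)[of q]
          by (cases "q \<in> N") (auto intro: mult_right_mono)
      qed (use h' in \<open>auto intro: integrable_kernel_mult\<close>)
      finally show ?thesis by (simp add: potential_def)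
    qed
    then have *: "potential \<mu> k f (T x) * h x \<le> potential \<mu> k h x * h x" for x
      using h_supp[of x] h'(2)[of x] by (cases "x \<in> N") (auto intro: mult_right_mono)
    have "interaction f = (\<integral>x. potential \<mu> k f (T x) * h x \<partial>\<mu>)"
      by (rule change) auto
    also have "\<dots> \<le> interaction h"
    proof (rule integral_mono[OF _ _ *])
      show "integrable \<mu> (\<lambda>x. potential \<mu> k f (T x) * h x)"
        using integrable_potential_mult[OF f(1) f_nonneg f(1)] by (subst (asm) change) auto
    qed (use h' in \<open>auto intro: integrable_potential_mult\<close>)
    finally show ?thesis .
  qed
  ultimately show ?thesis
    using f_adm ent by (intro that[of f]) (simp_all add: mult.commute)
qed

section \<open>Comparison of a minimizer with its transported restriction\<close>

text \<open>Minimality of \<open>g\<close> is tested against the transport of its normalized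
  restriction to \<open>N\<close>. On the right stand, in order: the cost of rescaling the inside
  part, the interaction saved by dropping the outside mass \<open>1 - m\<close>, a bound for minus
  the \<open>neg_entropy\<close> of the outside part with free parameter \<open>t\<close>, and the
  shift \<open>- ln m\<close> from normalization.\<close>

lemma minimizer_mass_outside:
  fixes g :: "'a \<Rightarrow> real"
  defines "m \<equiv> \<integral>x. indicator N x * g x \<partial>\<mu>"
  assumes T_inj: "inj_on T N"
    and T_kernel: "\<And>p q. p \<in> N \<Longrightarrow> q \<in> N \<Longrightarrow> k (T p) (T q) \<le> k p q"
    and g_min: "is_minimizer \<mu> k b g" and b: "0 \<le> b"
    and E: "free_energy \<mu> k b g \<le> ereal E"
    and m_ge: "1 / 2 \<le> m" and t: "0 < t" and \<kappa>: "0 \<le> \<kappa>"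
    and pot: "\<And>q. q \<notin> N \<Longrightarrow> \<kappa> \<le> potential \<mu> k (\<lambda>x. indicator N x * g x) q"
  shows "ln c \<le> 2 * (1 - m) * (3 * E + 7) - b / 2 * \<kappa> * (1 - m) + t - (1 - m) * ln t - ln m"
proof -
  have g_adm: "admissible \<mu> g" using g_min by (simp add: is_minimizer_def)
  then have g: "integrable \<mu> g" "\<And>x. 0 \<le> g x" "(\<integral>x. g x \<partial>\<mu>) = 1"
    by (auto simp: admissible_iff)
  have g_ent: "integrable \<mu> (\<lambda>x. g x * ln (g x))"
    using g_adm b E by (intro integrable_entropy_if_finite_free_energy) (auto intro: order_le_less_trans)
  define G where "G x = indicator N x * g x" for x
  define H where "H x = indicator (- N) x * g x" for x
  have GH: "g x = G x + H x" for x by (simp add: G_def H_def split: split_indicator)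
  have NS: "N \<in> sets \<mu>" "- N \<in> sets \<mu>" using N by (auto simp: sets_eq_borel)
  have G: "integrable \<mu> G" "\<And>x. 0 \<le> G x" "(\<integral>x. G x \<partial>\<mu>) = m"
    using g integrable_real_mult_indicator[OF NS(1) g(1)]
    by (auto simp: G_def[abs_def] m_def mult.commute)
  have H: "integrable \<mu> H" "\<And>x. 0 \<le> H x"
    using g integrable_real_mult_indicator[OF NS(2) g(1)]
    by (auto simp: H_def[abs_def] mult.commute)
  have H_mass: "(\<integral>x. H x \<partial>\<mu>) = 1 - m"
    using g(3) G H by (simp add: GH)
  then have m_le: "m \<le> 1" using H by (metis diff_ge_0_iff_ge integral_nonneg_AE AE_I2)
  have G_ln: "G x * ln (G x) = g x * ln (g x) * indicator N x"
    and H_ln: "H x * ln (H x) = g x * ln (g x) * indicator (- N) x" for x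
    by (auto simp: G_def H_def split: split_indicator)
  have G_ent: "integrable \<mu> (\<lambda>x. G x * ln (G x))"
    unfolding G_ln by (rule integrable_real_mult_indicator[OF NS(1) g_ent])
  have H_ent: "integrable \<mu> (\<lambda>x. H x * ln (H x))"
    unfolding H_ln by (rule integrable_real_mult_indicator[OF NS(2) g_ent])
  have "g x * ln (g x) = G x * ln (G x) + H x * ln (H x)" for x
    unfolding G_ln H_ln by (simp split: split_indicator)
  then have ent_split: "neg_entropy g = neg_entropy G + neg_entropy H"
    using G_ent H_ent by simp
  \<comment> \<open>Integrated tangent inequality: a small mass cannot have very negative
    \<open>neg_entropy\<close>. It is used with \<open>s = t\<close> and
    \<open>s = 1\<close>.\<close>
  have H_ent_ge: "(1 - m) * ln s + (1 - m) - s \<le> neg_entropy H" if s: "0 < s" for s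
  proof -
    have "(\<integral>x. H x * ln s + H x - s \<partial>\<mu>) \<le> neg_entropy H"
      using H H_ent mult_ln_ge[OF H(2) s] by (intro integral_mono) auto
    then show ?thesis using H H_mass by simp
  qed
  have G_ent_ge: "- 1 \<le> neg_entropy G"
  proof -
    have "(\<integral>x. - 1 \<partial>\<mu>) \<le> neg_entropy G"
      using G G_ent mult_ln_ge_minus_one[OF G(2)] by (intro integral_mono) auto
    then show ?thesis by simp
  qed
  have int_G: "integrable \<mu> (\<lambda>x. potential \<mu> k G x * G x)"
    using G by (intro integrable_potential_mult) auto
  have inter_G: "0 \<le> interaction G"
    using G by (intro integral_nonneg_AE AE_I2 mult_nonneg_nonneg potential_nonneg) auto
  \<comment> \<open>Expanding \<open>g = G + H\<close>, only the interaction of \<open>G\<close>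
    with itself and one copy of the cross term are kept; the rest is nonnegative. \<open>pot\<close>
    bounds the potential of \<open>G\<close> from below where \<open>H\<close> lives.\<close>
  have inter_g: "interaction G + \<kappa> * (1 - m) \<le> interaction g"
  proof -
    have "potential \<mu> k G x * G x + \<kappa> * H x \<le> potential \<mu> k g x * g x" for x
    proof -
      have "potential \<mu> k G x \<le> potential \<mu> k g x"
        using G g H by (intro potential_mono) (auto simp: GH)
      moreover have "\<kappa> * H x \<le> potential \<mu> k G x * H x"
        using pot[of x] H(2)[of x]
        by (cases "x \<in> N") (auto simp: H_def G_def[abs_def] intro: mult_right_mono)
      moreover have "potential \<mu> k G x * g x \<le> potential \<mu> k g x * g x"
        using calculation(1) g by (intro mult_right_mono) auto
      ultimately show ?thesis by (simp add: GH algebra_simps)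
    qed
    then have "(\<integral>x. potential \<mu> k G x * G x + \<kappa> * H x \<partial>\<mu>) \<le> interaction g"
      using g H int_G by (intro integral_mono Bochner_Integration.integrable_add int_G
        integrable_potential_mult[of g]) auto
    then show ?thesis using int_G H H_mass by simp
  qed

  \<comment> \<open>Normalizing divides the entropy by \<open>m\<close> and shifts it by
    \<open>- ln m\<close>; the quadratic interaction is divided by the square of
    \<open>m\<close>.\<close>
  define h where "h x = G x / m" for x
  have m_pos: "0 < m" using m_ge by simp
  have h_adm: "admissible \<mu> h"
    using G m_pos by (simp add: admissible_iff h_def[abs_def])
  have "h x * ln (h x) = (G x * ln (G x)) / m - ln m / m * G x" for x
    using G(2)[of x] m_pos by (cases "G x = 0") (auto simp: h_def ln_div field_simps)
  then have h_ent: "integrable \<mu> (\<lambda>x. h x * ln (h x))"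
      "neg_entropy h = neg_entropy G / m - ln m"
    using G_ent G m_pos by auto
  have "potential \<mu> k h x * h x = (potential \<mu> k G x * G x) / m\<^sup>2" for x
    by (simp add: potential_def h_def power2_eq_square)
  then have h_inter: "interaction h = interaction G / m\<^sup>2" by simp
  have h_supp: "h x = 0" if "x \<notin> N" for x using that by (simp add: h_def G_def)
  obtain f where f: "admissible \<mu> f" "integrable \<mu> (\<lambda>x. f x * ln (f x))"
      "neg_entropy f \<le> neg_entropy h - ln c" "interaction f \<le> interaction h"
    using transport_decreases_energy[OF T_inj T_kernel h_adm h_supp h_ent(1)] by blast
  have "free_energy \<mu> k b g \<le> free_energy \<mu> k b f"
    using g_min f(1) by (simp add: is_minimizer_def)
  then have g_le_f: "neg_entropy g + b / 2 * interaction g \<le> neg_entropy f + b / 2 * interaction f"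
    using free_energy_eq[OF g_adm g_ent, of b] free_energy_eq[OF f(1,2), of b] by simp
  have g_le_E: "neg_entropy g + b / 2 * interaction g \<le> E"
    using E free_energy_eq[OF g_adm g_ent, of b] by simp

  define S J where "S = neg_entropy G" and "J = b / 2 * interaction G"
  have J_nonneg: "0 \<le> J" using b inter_G by (simp add: J_def)
  have J_le: "J + b / 2 * \<kappa> * (1 - m) \<le> b / 2 * interaction g"
    using mult_left_mono[OF inter_g, of "b / 2"] b by (simp add: J_def distrib_left mult.assoc)
  have f_inter: "b / 2 * interaction f \<le> J / m\<^sup>2"
    using mult_left_mono[OF f(4), of "b / 2"] b by (simp add: J_def h_inter)
  have "ln c \<le> (S / m - S) + (J / m\<^sup>2 - J) - neg_entropy H - ln m - b / 2 * \<kappa> * (1 - m)"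
    using g_le_f f(3) f_inter J_le ent_split h_ent(2) unfolding S_def by linarith
  moreover have "- neg_entropy H \<le> t - (1 - m) * ln t"
    using H_ent_ge[OF t] m_le by linarith
  \<comment> \<open>The difference is \<open>(1 - m) * (1 / m)\<close> times
    \<open>S + (1 + 1 / m) * J\<close>. As \<open>1 / m <= 2\<close>, \<open>S >= -1\<close> and
    \<open>S + J <= E + 1\<close>, the second factor is at most
    \<open>S + 3 * J <= 3 * E + 5\<close>. The larger constant 7 makes the bound nonnegative too,
    because \<open>E >= -2\<close>, so that \<open>1 / m\<close> can then be replaced by 2.\<close>
  moreover have "(S / m - S) + (J / m\<^sup>2 - J) \<le> 2 * (1 - m) * (3 * E + 7)"
  proof -
    have "- 1 \<le> neg_entropy H" using H_ent_ge[of 1] m_le by simp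
    moreover have "0 \<le> b / 2 * \<kappa> * (1 - m)" using b \<kappa> m_le by simp
    ultimately have SJ: "S + J \<le> E + 1"
      using g_le_E J_le ent_split unfolding S_def by linarith
    have S_ge: "- 1 \<le> S" using G_ent_ge by (simp add: S_def)
    have inv_m: "1 \<le> 1 / m" "1 / m \<le> 2" using m_ge m_le by (simp_all add: field_simps)
    have "(S / m - S) + (J / m\<^sup>2 - J) = (1 - m) * (1 / m) * (S + (1 + 1 / m) * J)"
      using m_pos by (simp add: field_simps power2_eq_square)
    also have "\<dots> \<le> (1 - m) * (1 / m) * (3 * E + 7)"
    proof (rule mult_left_mono)
      have "(1 + 1 / m) * J \<le> 3 * J" using inv_m J_nonneg by (intro mult_right_mono) auto
      then show "S + (1 + 1 / m) * J \<le> 3 * E + 7" using SJ S_ge by linarith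
    qed (use m_pos m_le in simp)
    also have "\<dots> \<le> 2 * (1 - m) * (3 * E + 7)"
    proof (rule mult_right_mono)
      show "(1 - m) * (1 / m) \<le> 2 * (1 - m)"
        using mult_left_mono[OF inv_m(2), of "1 - m"] m_le by linarith
    qed (use SJ S_ge J_nonneg in linarith)
    finally show ?thesis .
  qed
  ultimately show ?thesis by linarith
qed

end

section \<open>Weak limits and mass near a closed set\<close>

text \<open>Weak convergence is tested on a continuous cutoff between the indicators of
  \<open>A\<close> and \<open>nbhd A e\<close>. Its limit integral is 1, and the masses are squeezed
  between its integrals and 1.\<close>

lemma weak_conv_nbhd_mass:
  fixes \<nu> :: "'a measure" and g :: "nat \<Rightarrow> 'a \<Rightarrow> real"
  assumes \<nu>: "sets \<nu> = sets borel" "prob_space \<nu>" "measure \<nu> A = 1" and A: "closed A" and e: "0 < e"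
    and g: "\<And>n. admissible \<mu> (g n)"
    and weak: "weak_conv (\<lambda>n. density \<mu> (\<lambda>x. ennreal (g n x))) \<nu>"
  shows "(\<lambda>n. \<integral>x. indicator (nbhd A e) x * g n x \<partial>\<mu>) \<longlonglongrightarrow> 1"
proof -
  interpret \<nu>: prob_space \<nu> by fact
  have A_ne: "A \<noteq> {}" using \<nu>(3) by auto
  \<comment> \<open>Equal to 1 on \<open>A\<close>, decreasing linearly with the distance, and 0
    from distance \<open>e\<close> on; \<open>A\<close> is nonempty, so \<open>infdist\<close> is
    the true distance.\<close>
  define \<phi> where "\<phi> x = max 0 (1 - infdist x A / e)" for x
  have cont: "continuous_on UNIV \<phi>"
    unfolding \<phi>_def by (intro continuous_intros) (use e in auto)
  have [measurable]: "\<phi> \<in> borel_measurable borel"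
    using cont by (rule borel_measurable_continuous_onI)
  have \<phi>_bounds: "0 \<le> \<phi> x" "\<phi> x \<le> 1" for x
    using e infdist_nonneg[of x A] by (auto simp: \<phi>_def)
  have \<phi>_A: "indicator A x \<le> \<phi> x" for x
    using e by (auto simp: \<phi>_def split: split_indicator)
  have \<phi>_nbhd: "\<phi> x \<le> indicator (nbhd A e) x" for x
  proof (cases "x \<in> nbhd A e")
    case False
    then have "e \<le> infdist x A"
      unfolding infdist_notempty[OF A_ne] using A_ne
      by (intro cINF_greatest) (auto simp: nbhd_def not_less)
    then show ?thesis using e False by (simp add: \<phi>_def field_simps)
  qed (use \<phi>_bounds in auto)
  have V: "nbhd A e \<in> sets \<mu>" by (simp add: sets_eq_borel)
  have A_sets: "A \<in> sets \<nu>" using A \<nu>(1) by simp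
  have \<phi>_int: "integrable \<nu> \<phi>"
  proof (rule \<nu>.integrable_const_bound[of _ 1])
    show "\<phi> \<in> borel_measurable \<nu>" using \<nu>(1) by (subst measurable_cong_sets[OF \<nu>(1) refl]) auto
  qed (use \<phi>_bounds in auto)
  have "(\<integral>x. indicator A x \<partial>\<nu>) \<le> (\<integral>x. \<phi> x \<partial>\<nu>)"
    using \<phi>_int \<phi>_A A_sets by (intro integral_mono) (auto simp: less_top[symmetric])
  then have "1 \<le> (\<integral>x. \<phi> x \<partial>\<nu>)" using \<nu>(3) A_sets by simp
  moreover have "(\<integral>x. \<phi> x \<partial>\<nu>) \<le> 1"
    using \<phi>_int \<phi>_bounds by (intro \<nu>.integral_le_const) auto
  ultimately have \<phi>_one: "(\<integral>x. \<phi> x \<partial>\<nu>) = 1" by simp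
  have "bounded (range \<phi>)"
    using \<phi>_bounds by (intro boundedI[of _ 1]) auto
  with weak cont have lim: "(\<lambda>n. \<integral>x. \<phi> x \<partial>(density \<mu> (\<lambda>x. ennreal (g n x)))) \<longlonglongrightarrow> 1"
    unfolding weak_conv_def \<phi>_one[symmetric] by blast
  have g': "integrable \<mu> (g n)" "0 \<le> g n x" "(\<integral>x. g n x \<partial>\<mu>) = 1" for n x
    using g[of n] by (auto simp: admissible_iff)
  have g_meas [measurable]: "g n \<in> borel_measurable borel" for n
    using borel_measurable_integrable[OF g'(1)] by simp
  have V_int: "integrable \<mu> (\<lambda>x. indicator (nbhd A e) x * g n x)" for n
    using integrable_real_mult_indicator[OF V g'(1)] by (simp add: mult.commute)
  have lower: "(\<integral>x. \<phi> x \<partial>(density \<mu> (\<lambda>x. ennreal (g n x))))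
      \<le> (\<integral>x. indicator (nbhd A e) x * g n x \<partial>\<mu>)" for n
  proof -
    have "(\<integral>x. \<phi> x \<partial>(density \<mu> (\<lambda>x. ennreal (g n x)))) = (\<integral>x. g n x * \<phi> x \<partial>\<mu>)"
      using g' by (subst integral_density) auto
    also have "\<dots> \<le> (\<integral>x. indicator (nbhd A e) x * g n x \<partial>\<mu>)"
    proof (rule integral_mono[OF _ V_int])
      show "integrable \<mu> (\<lambda>x. g n x * \<phi> x)"
      proof (rule Bochner_Integration.integrable_bound[OF g'(1)])
        show "AE x in \<mu>. norm (g n x * \<phi> x) \<le> norm (g n x)"
          using g'(2) \<phi>_bounds by (intro AE_I2) (simp add: mult_left_le)
      qed auto
      show "g n x * \<phi> x \<le> indicator (nbhd A e) x * g n x" for x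
        using mult_left_mono[OF \<phi>_nbhd g'(2)] by (simp add: mult.commute)
    qed
    finally show ?thesis .
  qed
  have upper: "(\<integral>x. indicator (nbhd A e) x * g n x \<partial>\<mu>) \<le> 1" for n
    unfolding g'(3)[symmetric, of n] using g'
    by (intro integral_mono V_int) (auto split: split_indicator)
  show ?thesis
    by (rule tendsto_sandwich[OF _ _ lim tendsto_const]) (use lower upper in auto)
qed

end

section \<open>The contradiction from full limit mass on \<open>A1\<close>\<close>

theorem theorem3:
  fixes \<mu> \<nu> :: "'a::metric_space measure"
    and k :: "'a \<Rightarrow> 'a \<Rightarrow> real"
    and L c \<epsilon>0 \<epsilon>1 :: real
    and A0 A1 :: "'a set"
    and T :: "'a \<Rightarrow> 'a"
    and b :: "nat \<Rightarrow> real"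
    and g :: "nat \<Rightarrow> 'a \<Rightarrow> real"
  assumes compact_M: "compact (UNIV :: 'a set)"
    and mu_borel: "sets \<mu> = sets borel" and mu_prob: "prob_space \<mu>"
    and k_nonneg: "\<And>p q. 0 \<le> k p q"
    and k_sym: "\<And>p q. k p q = k q p"
    and k_diag: "\<And>p. k p p = 0"
    and L_pos: "L > 0"
    and k_lip: "\<And>p q s. \<bar>k p s - k q s\<bar> \<le> L * dist p q"
    and A0_compact: "compact A0" and A1_compact: "compact A1"
    and k_A0: "\<And>p q. p \<in> A0 \<Longrightarrow> q \<in> A0 \<Longrightarrow> k p q = 0"
    and k_A1: "\<And>p q. p \<in> A1 \<Longrightarrow> q \<in> A1 \<Longrightarrow> k p q = 0"
    and eps0: "\<epsilon>0 > 0" and eps1: "\<epsilon>1 > 0"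
    and T_inj: "inj_on T (nbhd A1 \<epsilon>1)"
    and T_into: "T ` nbhd A1 \<epsilon>1 \<subseteq> nbhd A0 \<epsilon>0"
    and T_meas: "\<And>C. C \<in> sets borel \<Longrightarrow> T -` C \<inter> nbhd A1 \<epsilon>1 \<in> sets borel"
    and T_inv_meas: "\<And>B. B \<in> sets borel \<Longrightarrow> B \<subseteq> nbhd A1 \<epsilon>1 \<Longrightarrow> T ` B \<in> sets borel"
    and c_gt: "c > 1"
    and T_k: "\<And>p q. p \<in> nbhd A1 \<epsilon>1 \<Longrightarrow> q \<in> nbhd A1 \<epsilon>1 \<Longrightarrow> k (T p) (T q) \<le> k p q"
    and T_mu: "\<And>B. B \<in> sets \<mu> \<Longrightarrow> B \<subseteq> nbhd A1 \<epsilon>1 \<Longrightarrow>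
                 measure \<mu> (T ` B) \<ge> c * measure \<mu> B"
    and k_pos: "\<And>p q. p \<in> A1 \<Longrightarrow> q \<notin> nbhd A1 \<epsilon>1 \<Longrightarrow> k p q > 0"
    and nu_borel: "sets \<nu> = sets borel" and nu_prob: "prob_space \<nu>"
    and b_pos: "\<And>n. b n > 0"
    and b_lim: "filterlim b at_top sequentially"
    and g_min: "\<And>n. is_minimizer \<mu> k (b n) (g n)"
    and weak: "weak_conv (\<lambda>n. density \<mu> (\<lambda>x. ennreal (g n x))) \<nu>"
  shows "measure \<nu> A1 < 1"
proof (rule ccontr)
  assume "\<not> measure \<nu> A1 < 1"
  interpret lipschitz_interaction \<mu> k L
    by (intro lipschitz_interaction.intro lipschitz_interaction_axioms.intro)
      (fact mu_prob compact_M mu_borel k_nonneg k_sym L_pos k_lip)+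
  have \<nu>_A1: "measure \<nu> A1 = 1"
    using \<open>\<not> measure \<nu> A1 < 1\<close> prob_space.prob_le_1[OF nu_prob, of A1] by simp
  have A1_closed: "closed A1" using A1_compact by (rule compact_imp_closed)
  have g_adm: "admissible \<mu> (g n)" for n using g_min by (simp add: is_minimizer_def)
  then have g: "integrable \<mu> (g n)" "0 \<le> g n x" "(\<integral>x. g n x \<partial>\<mu>) = 1" for n x
    by (auto simp: admissible_iff)
  define N where "N = nbhd A1 \<epsilon>1"
  have N: "N \<in> sets borel" "open N" by (auto simp: N_def open_nbhd)

  \<comment> \<open>\<open>k\<close> is continuous and positive on the compact product of
    \<open>A1\<close> with the complement of \<open>N\<close>, so it attains a positive minimum; if
    the product is empty, any positive number serves.\<close>
  obtain \<kappa> where \<kappa>: "0 < \<kappa>" "\<And>p q. p \<in> A1 \<Longrightarrow> q \<notin> N \<Longrightarrow> \<kappa> \<le> k p q"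
  proof (cases "A1 \<times> (- N) = {}")
    case False
    have "compact (UNIV \<inter> - N)"
      using compact_M N by (intro compact_Int_closed) auto
    then have "compact (A1 \<times> (- N))" using A1_compact by (intro compact_Times) auto
    then obtain z where z: "z \<in> A1 \<times> (- N)"
      "\<And>y. y \<in> A1 \<times> (- N) \<Longrightarrow> (case z of (p, q) \<Rightarrow> k p q) \<le> (case y of (p, q) \<Rightarrow> k p q)"
      using continuous_attains_inf[OF _ False continuous_on_kernel] by blast
    show ?thesis
      using z k_pos by (intro that[of "k (fst z) (snd z)"]) (force simp: N_def)+
  qed (auto intro: that[of 1])
  \<comment> \<open>\<open>48\<close> makes \<open>6 b L \<eta>\<close>, the \<open>b\<close>-dependent cost of renormalization per unit of mass, at most
    the saving \<open>(b / 2) (\<kappa> / 4)\<close>.\<close>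
  define \<eta> where "\<eta> = min \<epsilon>1 (\<kappa> / (48 * L))"
  have \<eta>: "0 < \<eta>" "\<eta> \<le> \<epsilon>1" "48 * (L * \<eta>) \<le> \<kappa>"
  proof -
    have "\<eta> \<le> \<kappa> / (48 * L)" by (simp add: \<eta>_def)
    then show "48 * (L * \<eta>) \<le> \<kappa>" using L_pos by (simp add: field_simps)
  qed (use eps1 \<kappa> L_pos in \<open>auto simp: \<eta>_def\<close>)
  define V where "V = nbhd A1 \<eta>"
  have V_sets: "V \<in> sets borel" by (simp add: V_def)
  have V_N: "V \<subseteq> N" using \<eta>(2) by (force simp: V_def N_def nbhd_def)
  \<comment> \<open>\<open>k\<close> vanishes on pairs from \<open>A1\<close>, and moving each
    argument by less than \<open>\<eta>\<close> changes it by at most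
    \<open>L * \<eta>\<close>.\<close>
  have k_VV: "k p q \<le> 2 * L * \<eta>" if "p \<in> V" "q \<in> V" for p q
  proof -
    obtain p' q' where *: "p' \<in> A1" "q' \<in> A1" "dist p p' < \<eta>" "dist q q' < \<eta>"
      using \<open>p \<in> V\<close> \<open>q \<in> V\<close> by (auto simp: V_def nbhd_def)
    then have "L * dist p p' \<le> L * \<eta>" "L * dist q q' \<le> L * \<eta>"
      using L_pos by (auto intro!: mult_left_mono)
    then show ?thesis
      using kernel_perturb[of p q p' q'] k_A1[OF *(1,2)] by linarith
  qed
  \<comment> \<open>Moving one argument off \<open>A1\<close> costs at most
    \<open>L * \<eta>\<close>, hence at most \<open>\<kappa> / 48\<close>, so half of
    \<open>\<kappa>\<close> survives.\<close>
  have k_V: "\<kappa> / 2 \<le> k q p" if p: "p \<in> V" and q: "q \<notin> N" for p q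
  proof -
    obtain p' where *: "p' \<in> A1" "dist p p' < \<eta>"
      using p by (auto simp: V_def nbhd_def)
    then have "L * dist p p' \<le> L * \<eta>" using L_pos by (auto intro!: mult_left_mono)
    then show ?thesis
      using k_lip[of p q p'] \<kappa>(2)[OF *(1) q] \<eta>(3) \<kappa>(1) k_sym[of q p] by linarith
  qed

  \<comment> \<open>Two masses are tracked: \<open>v\<close> on the thin set \<open>V\<close> feeds
    the lower bound for the potential outside \<open>N\<close>, and \<open>m\<close> on
    \<open>N\<close> is the mass that gets transported.\<close>
  define v where "v n = (\<integral>x. indicator V x * g n x \<partial>\<mu>)" for n
  define m where "m n = (\<integral>x. indicator N x * g n x \<partial>\<mu>)" for n
  have int: "integrable \<mu> (\<lambda>x. indicator B x * g n x)" if "B \<in> sets borel" for B n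
    using that integrable_real_mult_indicator[OF _ g(1), of B n]
    by (simp add: mult.commute sets_eq_borel)
  have v_lim: "v \<longlonglongrightarrow> 1"
    unfolding v_def V_def
    by (rule weak_conv_nbhd_mass[OF nu_borel nu_prob \<nu>_A1 A1_closed \<eta>(1) g_adm weak])
  have m_lim: "m \<longlonglongrightarrow> 1"
    unfolding m_def N_def
    by (rule weak_conv_nbhd_mass[OF nu_borel nu_prob \<nu>_A1 A1_closed eps1 g_adm weak])
  have m_le: "m n \<le> 1" for n
    unfolding m_def g(3)[symmetric, of n] using g
    by (intro integral_mono int N) (auto split: split_indicator)
  have v_ev: "\<forall>\<^sub>F n in sequentially. 1 / 2 < v n" by (rule order_tendstoD[OF v_lim]) simp
  have m_ev: "\<forall>\<^sub>F n in sequentially. 1 / 2 < m n" by (rule order_tendstoD[OF m_lim]) simp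
  \<comment> \<open>The minimizers are densities, so a null \<open>V\<close> would carry no mass of
    any of them, against \<open>v_lim\<close>. Positivity is what admits the uniform density on
    \<open>V\<close>.\<close>
  have V_pos: "0 < prob V"
  proof (rule ccontr)
    assume "\<not> 0 < prob V"
    then have "emeasure \<mu> V = 0"
      by (simp add: emeasure_eq_measure zero_less_measure_iff)
    then have "V \<in> null_sets \<mu>"
      using V_sets by (intro null_setsI) (simp_all add: sets_eq_borel)
    from AE_not_in[OF this] have AE_V: "AE x in \<mu>. x \<notin> V" .
    have "AE x in \<mu>. indicator V x * g n x = 0" for n
      using AE_V by eventually_elim simp
    then have "v = (\<lambda>_. 0)"
      unfolding v_def by (intro ext integral_eq_zero_AE)
    with v_lim show False by (simp add: LIMSEQ_const_iff)
  qed

  define C where "C = - ln (prob V)"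
  \<comment> \<open>The upper bound for \<open>ln c\<close> obtained below tends to \<open>t\<close>
    as \<open>m n\<close> tends to 1; half of \<open>ln c\<close> makes that limit too
    small.\<close>
  define t where "t = ln c / 2"
  have t: "0 < t" using c_gt by (simp add: t_def)
  have "\<forall>\<^sub>F n in sequentially.
      ln c \<le> 2 * (1 - m n) * (3 * C + 7) + t - (1 - m n) * ln t - ln (m n)"
    using v_ev m_ev
  proof eventually_elim
    case (elim n)
    \<comment> \<open>By \<open>k_VV\<close> the uniform density on \<open>V\<close> has energy at
      most \<open>C + b n * (L * \<eta>)\<close>, so the minimal energy grows in \<open>b n\<close>
      with slope at most \<open>L * \<eta>\<close>.\<close>
    obtain w where w: "admissible \<mu> w"
        "free_energy \<mu> k (b n) w \<le> ereal (b n / 2 * (2 * L * \<eta>) - ln (prob V))"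
      using free_energy_uniform_density[OF V_sets V_pos, of "b n" "2 * L * \<eta>"] k_VV b_pos[of n]
      by (metis less_imp_le)
    have E: "free_energy \<mu> k (b n) (g n) \<le> ereal (C + b n * (L * \<eta>))"
    proof -
      have "free_energy \<mu> k (b n) (g n) \<le> free_energy \<mu> k (b n) w"
        using g_min w(1) by (simp add: is_minimizer_def)
      also note w(2)
      finally show ?thesis by (simp add: C_def algebra_simps)
    qed
    \<comment> \<open>More than half of the mass of \<open>g n\<close> sits in \<open>V\<close>,
      where \<open>k_V\<close> bounds the kernel below by \<open>\<kappa> / 2\<close>.\<close>
    have pot: "\<kappa> / 4 \<le> potential \<mu> k (\<lambda>x. indicator N x * g n x) q" if q: "q \<notin> N" for q
    proof -
      have "\<kappa> / 4 \<le> \<kappa> / 2 * v n" using elim \<kappa>(1) by (simp add: field_simps)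
      also have "\<dots> = (\<integral>x. \<kappa> / 2 * (indicator V x * g n x) \<partial>\<mu>)"
        using int[OF V_sets] by (simp add: v_def)
      also have "\<dots> \<le> potential \<mu> k (\<lambda>x. indicator N x * g n x) q"
        unfolding potential_def
      proof (rule integral_mono)
        show "integrable \<mu> (\<lambda>x. k q x * (indicator N x * g n x))"
          using int[OF N(1)] g by (intro integrable_kernel_mult) auto
        show "\<kappa> / 2 * (indicator V x * g n x) \<le> k q x * (indicator N x * g n x)" for x
        proof (cases "x \<in> V")
          case True
          then show ?thesis
            using mult_right_mono[OF k_V[OF True q] g(2)[of n x]] V_N by auto
        next
          case False
          then show ?thesis using g(2)[of n x] k_nonneg[of q x] by simp
        qed
      qed (use int[OF V_sets] in auto)
      finally show ?thesis .
    qed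
    have "ln c \<le> 2 * (1 - m n) * (3 * (C + b n * (L * \<eta>)) + 7) - b n / 2 * (\<kappa> / 4) * (1 - m n)
        + t - (1 - m n) * ln t - ln (m n)"
      unfolding m_def
    proof (rule minimizer_mass_outside[OF N(1) _ _ _ c_gt _ _ g_min _ E _ t _ pot])
      show "c * prob B \<le> prob (T ` B)" if "B \<in> sets borel" "B \<subseteq> N" for B
        using that T_mu by (simp add: N_def mu_borel)
    qed (use T_meas T_inv_meas T_inj T_k b_pos[of n] elim \<kappa>(1) in \<open>auto simp: N_def m_def\<close>)
    \<comment> \<open>The \<open>b n\<close> part of the rescaling cost is absorbed by the
      interaction saving, which leaves a bound in \<open>m n\<close> alone.\<close>
    moreover have "2 * (1 - m n) * (3 * (b n * (L * \<eta>))) \<le> b n / 2 * (\<kappa> / 4) * (1 - m n)"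
    proof -
      have "(1 - m n) * b n * (48 * (L * \<eta>)) \<le> (1 - m n) * b n * \<kappa>"
        using \<eta>(3) m_le[of n] b_pos[of n] by (intro mult_left_mono) auto
      then show ?thesis by (simp add: algebra_simps)
    qed
    moreover have "2 * (1 - m n) * (3 * (C + b n * (L * \<eta>)) + 7)
        = 2 * (1 - m n) * (3 * C + 7) + 2 * (1 - m n) * (3 * (b n * (L * \<eta>)))"
      by (simp add: algebra_simps)
    ultimately show ?case by linarith
  qed
  moreover have "(\<lambda>n. 2 * (1 - m n) * (3 * C + 7) + t - (1 - m n) * ln t - ln (m n))
      \<longlonglongrightarrow> 2 * (1 - 1) * (3 * C + 7) + t - (1 - 1) * ln t - ln 1"
    by (intro tendsto_intros m_lim) simp
  ultimately have "ln c \<le> 2 * (1 - 1) * (3 * C + 7) + t - (1 - 1) * ln t - ln 1"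
    by (intro tendsto_lowerbound) auto
  then show False using t by (simp add: t_def)
qed

end
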